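(* The arc number of an undecorated chord diagram $D=(C,\{h_1,\dots,h_{2n}\},X)$ may be computed in $O(n^2)$ time. That is, there is an algorithm which, given any undecorated chord diagram $D$ with $2n$ half-crossings $h_1,\dots,h_{2n}$ (equivalently, with $n$ crossings), outputs the arc number of $D$ in $O(n^2)$ time.
   Context: An undecorated chord diagram $D=(C,H,X)$ consists of an oriented circle $C$, a set $H\subset C$ of half-crossings having finite, even cardinality, and a partition $X$ of $H$ into two-element sets, called (full) crossings. When $H=\{h_1,\dots,h_{2n}\}$ the subscripts are understood modulo $2n$ and their cyclic order is the order of the points along $C$, respecting the orientation. For computational purposes each open arc $(h_i,h_{i+1})$ between adjacent half-crossings is identified with a single point, so the diagram is given by the cyclically ordered list of its half-crossings together with the pairing $X$. Running time is counted in elementary operations on indices (such as looking up the partner of a half-crossing), each at unit cost. A regular point of $D$ is an element of $C\setminus H$. A regular arc is an open arc $r\subset C$ with $\partial r\subset C\setminus H$ (the complement of a single regular point counts as an open arc; the whole circle $C$ does not). A regular arc is properly embedded if it contains no full crossing, i.e. there is no $x\in X$ with $x\subset r$. An embedded partition of $D$ is a finite set of regular points, called cut points, such that every component of the complement in $C$ of this set is a properly embedded regular arc. The arc number of $D$ is the smallest number of arcs (equivalently, of cut points) in an embedded partition of $D$. *)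

theory Defs
  imports "HOL-Analysis.Analysis" "HOL-Library.Disjoint_Sets" "HOL-Library.Landau_Symbols"
begin

section \<open>Chord diagrams and their arc number\<close>

text \<open>The oriented circle is the unit circle of the complex plane, oriented counterclockwise.\<close>

abbreviation circle :: "complex set" where
  "circle \<equiv> sphere 0 1"

record chord_diagram =
  half_crossings :: "complex set"
  crossings :: "complex set set"

definition is_chord_diagram :: "chord_diagram \<Rightarrow> bool" where
  "is_chord_diagram D \<longleftrightarrow>
     half_crossings D \<subseteq> circle \<and> finite (half_crossings D) \<and> even (card (half_crossings D)) \<and>
     partition_on (half_crossings D) (crossings D) \<and> (\<forall>x\<in>crossings D. card x = 2)"

definition regular_points :: "chord_diagram \<Rightarrow> complex set" where
  "regular_points D = circle - half_crossings D"

text \<open>The open arc from \<open>cis a\<close> counterclockwise to \<open>cis b\<close> has boundary \<open>{cis a, cis b}\<close>. For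
  \<open>b = a + 2 * pi\<close> it is the complement of the single point \<open>cis a\<close>; the whole circle is never
  of this form.\<close>

definition regular_arc :: "chord_diagram \<Rightarrow> complex set \<Rightarrow> bool" where
  "regular_arc D r \<longleftrightarrow>
     (\<exists>a b. a < b \<and> b \<le> a + 2 * pi \<and> r = cis ` {a<..<b} \<and> {cis a, cis b} \<subseteq> regular_points D)"

definition properly_embedded :: "chord_diagram \<Rightarrow> complex set \<Rightarrow> bool" where
  "properly_embedded D r \<longleftrightarrow> \<not> (\<exists>x\<in>crossings D. x \<subseteq> r)"

definition embedded_partition :: "chord_diagram \<Rightarrow> complex set \<Rightarrow> bool" where
  "embedded_partition D P \<longleftrightarrow>
     finite P \<and> P \<subseteq> regular_points D \<and>
     (\<forall>r\<in>components (circle - P). regular_arc D r \<and> properly_embedded D r)"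

definition arc_number :: "chord_diagram \<Rightarrow> nat" where
  "arc_number D = (LEAST k. \<exists>P. embedded_partition D P \<and> k = card (components (circle - P)))"


section \<open>Combinatorial presentation of a chord diagram\<close>

text \<open>The list enumerates all half-crossings, without repetition, in the order in which they occur
  in one counterclockwise turn. The half-crossing that comes first is arbitrary.\<close>

definition cyclic_enumeration :: "chord_diagram \<Rightarrow> complex list \<Rightarrow> bool" where
  "cyclic_enumeration D hs \<longleftrightarrow>
     set hs = half_crossings D \<and>
     (\<exists>\<theta>s. hs = map cis \<theta>s \<and> sorted_wrt (<) \<theta>s \<and> (\<forall>\<theta>\<in>set \<theta>s. \<theta> < hd \<theta>s + 2 * pi))"

text \<open>Half-crossings are indexed from 0. Since crossings have two elements and are pairwise
  disjoint, the table is determined by \<open>D\<close> and \<open>hs\<close>.\<close>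

definition partner_table :: "chord_diagram \<Rightarrow> complex list \<Rightarrow> nat list \<Rightarrow> bool" where
  "partner_table D hs ps \<longleftrightarrow>
     length ps = length hs \<and>
     (\<forall>i<length hs. ps ! i < length hs \<and> {hs ! i, hs ! (ps ! i)} \<in> crossings D)"


section \<open>Programs on a unit-cost random access machine\<close>

text \<open>A state consists of registers and of an indirectly addressed memory. The only arithmetic
  is adding or subtracting one, so that \<open>t\<close> steps raise the largest stored number by at most
  \<open>t\<close> (apart from constants of the program) and unit cost cannot be exploited to compute with
  numbers that are not of the size of indices.\<close>

type_synonym state = "(nat \<Rightarrow> nat) \<times> (nat \<Rightarrow> nat)"

datatype test = Less nat nat | Equal nat nat

datatype program =
    Skip
  | Const nat nat
  | Copy nat nat
  | Inc nat
  | Dec nat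
  | Load nat nat
  | Store nat nat
  | Seq program program
  | IfElse test program program
  | While test program

fun holds :: "test \<Rightarrow> state \<Rightarrow> bool" where
  "holds (Less x y) (R, M) \<longleftrightarrow> R x < R y"
| "holds (Equal x y) (R, M) \<longleftrightarrow> R x = R y"

text \<open>\<open>exec c s t s'\<close>: started in state \<open>s\<close>, the program \<open>c\<close> terminates in state \<open>s'\<close> after
  exactly \<open>t\<close> elementary operations. Every basic instruction and every evaluation of a test
  counts as one.\<close>

inductive exec :: "program \<Rightarrow> state \<Rightarrow> nat \<Rightarrow> state \<Rightarrow> bool" where
  Skip: "exec Skip s 1 s"
| Const: "exec (Const x k) (R, M) 1 (R(x := k), M)"
| Copy: "exec (Copy x y) (R, M) 1 (R(x := R y), M)"
| Inc: "exec (Inc x) (R, M) 1 (R(x := R x + 1), M)"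
| Dec: "exec (Dec x) (R, M) 1 (R(x := R x - 1), M)"
| Load: "exec (Load x y) (R, M) 1 (R(x := M (R y)), M)"
| Store: "exec (Store x y) (R, M) 1 (R, M(R x := R y))"
| Seq: "exec c1 s t1 s' \<Longrightarrow> exec c2 s' t2 s'' \<Longrightarrow> exec (Seq c1 c2) s (t1 + t2) s''"
| IfTrue: "holds b s \<Longrightarrow> exec c1 s t s' \<Longrightarrow> exec (IfElse b c1 c2) s (1 + t) s'"
| IfFalse: "\<not> holds b s \<Longrightarrow> exec c2 s t s' \<Longrightarrow> exec (IfElse b c1 c2) s (1 + t) s'"
| WhileTrue: "holds b s \<Longrightarrow> exec c s t1 s' \<Longrightarrow> exec (While b c) s' t2 s'' \<Longrightarrow>
    exec (While b c) s (1 + t1 + t2) s''"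
| WhileFalse: "\<not> holds b s \<Longrightarrow> exec (While b c) s 1 s"

text \<open>Initially register 0 holds the number of half-crossings and the memory holds the partner
  table, so that looking up a partner is one \<open>Load\<close>; everything else is 0. The result is
  delivered in register 0.\<close>

definition initial_state :: "nat list \<Rightarrow> state" where
  "initial_state ps = ((\<lambda>_. 0)(0 := length ps), \<lambda>i. if i < length ps then ps ! i else 0)"

definition result :: "state \<Rightarrow> nat" where
  "result s = fst s 0"

end

theory Submission
  imports Defs
begin

text \<open>The algorithm is greedy. Begin with a cut just before some half-crossing and walk
  once around the circle, cutting just before a half-crossing whenever passing it would complete
  a crossing inside the current arc. This gives an embedded partition
  (\<open>greedy_embedded_partition\<close>), since any two partners are separated by a cut.
  Conversely, let \<open>P\<close> be an embedded partition and let the walk begin at the first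
  half-crossing after some point of \<open>P\<close>. The walk prolongs each arc as far as
  possible, so by induction its cuts stay at or beyond the corresponding points of
  \<open>P\<close>, and the walk makes at most \<open>card P\<close> cuts
  (\<open>greedy_lower_bound\<close>). The arc number is therefore the minimum of the greedy
  counts over all starting half-crossings. There are \<open>2 * n\<close> starts, and each walk
  has \<open>2 * n\<close> steps.

  To pass between the circle and indices, a finite set of points on the circle is enumerated by
  a strictly increasing sequence of angles that gains \<open>2 * pi\<close> per period
  (\<open>angle_lift\<close>). The components of the complement of the set are the images of the
  gaps in this sequence (\<open>components_minus_lift\<close>). In particular, the number of
  arcs equals the number of cut points.

  A step of the walk takes constant time although the machine can only count: whether the
  partner of the current half-crossing lies in the current arc is a question about cyclic order,
  decided by a few comparisons of indices modulo \<open>2 * n\<close>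
  (\<open>cyclic_interval_iff\<close>). Thus the partner table is only read, and two nested
  loops with bodies of constant length give a quadratic bound.\<close>

section \<open>Angles enumerating a finite subset of the circle\<close>

lemma cis_eq_cis_iff: "cis x = cis y \<longleftrightarrow> (\<exists>z::int. x = y + 2 * pi * of_int z)"
proof -
  have "cis x = cis y \<longleftrightarrow> (\<exists>z::int. \<i> * of_real x = \<i> * of_real y + of_int (2 * z) * pi * \<i>)"
    by (simp add: cis_conv_exp exp_eq)
  also have "\<dots> \<longleftrightarrow> (\<exists>z::int. x = y + 2 * pi * of_int z)"
    by (auto simp: complex_eq_iff algebra_simps)
  finally show ?thesis .
qed

lemma cis_inj_within_turn:
  assumes "cis x = cis y" "\<bar>x - y\<bar> < 2 * pi"
  shows "x = y"
proof -
  obtain z :: int where z: "x = y + 2 * pi * of_int z"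
    using assms(1) cis_eq_cis_iff by blast
  with assms(2) have "2 * pi * \<bar>of_int z :: real\<bar> < 2 * pi * 1"
    by (simp add: abs_mult)
  then have "\<bar>of_int z :: real\<bar> < 1"
    by (simp only: mult_less_cancel_left_pos pi_gt_zero mult_pos_pos zero_less_numeral)
  then have "z = 0" by linarith
  with z show ?thesis by simp
qed

lemma circle_angle_in_turn:
  assumes "z \<in> circle"
  obtains x where "a \<le> x" "x < a + 2 * pi" "z = cis x"
proof -
  define n where "n = \<lfloor>(Arg z - a) / (2 * pi)\<rfloor>"
  define x where "x = Arg z - 2 * pi * of_int n"
  have "z \<noteq> 0" "norm z = 1" using assms by auto
  then have "z = cis (Arg z)" by (simp add: cis_Arg sgn_eq)
  also have "\<dots> = cis x"
    by (subst cis_eq_cis_iff) (auto simp: x_def intro!: exI[of _ n])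
  finally have "z = cis x" .
  moreover have "of_int n \<le> (Arg z - a) / (2 * pi)" "(Arg z - a) / (2 * pi) < of_int n + 1"
    unfolding n_def by linarith+
  then have "a \<le> x" "x < a + 2 * pi"
    by (simp_all add: x_def field_simps)
  ultimately show ?thesis using that by blast
qed

text \<open>A finite set of points on the circle is described by the angles of its points,
  continued periodically: one turn adds \<open>2 * pi\<close> to the angle and the number
  \<open>k\<close> of points to the index. Half-crossings and cut points both get such a lift,
  so that arcs become intervals of the line and wrapping around the circle is absorbed into the
  order of indices. The index set is \<open>nat\<close>, so the lift sees only angles from
  \<open>\<phi> 0\<close> on.\<close>

definition angle_lift :: "(nat \<Rightarrow> real) \<Rightarrow> nat \<Rightarrow> complex set \<Rightarrow> bool" where
  "angle_lift \<phi> k P \<longleftrightarrow>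
     0 < k \<and> strict_mono \<phi> \<and> (\<forall>i. \<phi> (i + k) = \<phi> i + 2 * pi) \<and> P = cis ` range \<phi>"

lemma angle_lift_less_iff: "angle_lift \<phi> k P \<Longrightarrow> \<phi> i < \<phi> j \<longleftrightarrow> i < j"
  by (simp add: angle_lift_def strict_mono_less)

lemma angle_lift_le_iff: "angle_lift \<phi> k P \<Longrightarrow> \<phi> i \<le> \<phi> j \<longleftrightarrow> i \<le> j"
  by (simp add: angle_lift_def strict_mono_less_eq)

lemma angle_lift_turn: "angle_lift \<phi> k P \<Longrightarrow> \<phi> (i + k) = \<phi> i + 2 * pi"
  by (simp add: angle_lift_def)

lemma angle_lift_turns:
  assumes "angle_lift \<phi> k P"
  shows "\<phi> (i + j * k) = \<phi> i + 2 * pi * real j"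
proof (induction j)
  case (Suc j)
  have "\<phi> (i + Suc j * k) = \<phi> ((i + j * k) + k)"
    by (simp add: algebra_simps)
  then show ?case
    using Suc angle_lift_turn[OF assms, of "i + j * k"] by (simp add: algebra_simps)
qed simp

lemma angle_lift_Suc_le_turn:
  assumes "angle_lift \<phi> k P"
  shows "\<phi> (Suc i) \<le> \<phi> i + 2 * pi"
  using angle_lift_turn[OF assms, of i] angle_lift_le_iff[OF assms, of "Suc i" "i + k"] assms
  by (auto simp: angle_lift_def)

lemma cis_angle_lift_in: "angle_lift \<phi> k P \<Longrightarrow> cis (\<phi> i) \<in> P"
  by (auto simp: angle_lift_def)

text \<open>An angle of a point of \<open>P\<close> differs from some value of the lift by whole
  turns, that is, by a multiple of \<open>k\<close> in the index; an angle not below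
  \<open>\<phi> 0\<close> keeps the shifted index nonnegative.\<close>

lemma angle_lift_range:
  assumes L: "angle_lift \<phi> k P" and "\<phi> 0 \<le> x" and "cis x \<in> P"
  obtains i where "x = \<phi> i"
proof -
  obtain j where "cis x = cis (\<phi> j)"
    using assms by (auto simp: angle_lift_def)
  then obtain z :: int where z: "x = \<phi> j + 2 * pi * of_int z"
    using cis_eq_cis_iff by blast
  show ?thesis
  proof (cases "0 \<le> z")
    case True
    then have "x = \<phi> (j + nat z * k)"
      using z by (simp add: angle_lift_turns[OF L])
    then show ?thesis using that by blast
  next
    case False
    define y where "y = nat (- z)"
    have x: "x = \<phi> j - 2 * pi * real y" using z False by (simp add: y_def)
    have "\<phi> (0 + y * k) \<le> \<phi> j"
      unfolding angle_lift_turns[OF L] using x assms(2) by simp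
    then have "y * k \<le> j" using angle_lift_le_iff[OF L] by simp
    then have "x = \<phi> (j - y * k)"
      using x angle_lift_turns[OF L, of "j - y * k" y] by simp
    then show ?thesis using that by blast
  qed
qed

lemma angle_lift_bracket:
  assumes L: "angle_lift \<phi> k P" and "\<phi> 0 \<le> x"
  obtains i where "\<phi> i \<le> x" "x < \<phi> (Suc i)"
proof -
  obtain j :: nat where "(x - \<phi> 0) / (2 * pi) < real j"
    using reals_Archimedean2 by blast
  then have ex: "x < \<phi> (0 + j * k)"
    unfolding angle_lift_turns[OF L] by (simp add: field_simps)
  define n where "n = (LEAST n. x < \<phi> n)"
  have n: "x < \<phi> n" unfolding n_def using ex by (rule LeastI)
  then have "n \<noteq> 0" using assms(2) by (metis not_le)
  then obtain i where i: "n = Suc i" by (cases n) auto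
  have "\<not> x < \<phi> i"
    using not_less_Least[of i "\<lambda>n. x < \<phi> n"] i by (simp add: n_def)
  then show ?thesis using that n i by force
qed

lemma angle_lift_of_list:
  assumes "xs \<noteq> []" and sorted: "sorted_wrt (<) xs"
    and turn: "\<And>x. x \<in> set xs \<Longrightarrow> x < hd xs + 2 * pi"
  shows "angle_lift (\<lambda>i. xs ! (i mod length xs) + 2 * pi * real (i div length xs))
           (length xs) (cis ` set xs)"
proof -
  define k where "k = length xs"
  define \<phi> where "\<phi> = (\<lambda>i. xs ! (i mod k) + 2 * pi * real (i div k))"
  have k: "0 < k" using assms(1) by (simp add: k_def)
  have mono: "\<phi> i < \<phi> (Suc i)" for i
  proof (cases "Suc (i mod k) = k")
    case True
    then have "Suc i mod k = 0" "Suc i div k = Suc (i div k)"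
      by (simp_all add: mod_Suc div_Suc)
    moreover have "xs ! (i mod k) < hd xs + 2 * pi"
      using turn k by (simp add: k_def)
    ultimately show ?thesis
      using assms(1) by (simp add: \<phi>_def hd_conv_nth algebra_simps)
  next
    case False
    then have "Suc i mod k = Suc (i mod k)" "Suc i div k = i div k" "Suc (i mod k) < k"
      using k by (auto simp: mod_Suc div_Suc Suc_lessI)
    then show ?thesis
      using sorted by (simp add: \<phi>_def k_def sorted_wrt_nth_less)
  qed
  have cis: "cis (\<phi> i) = cis (xs ! (i mod k))" for i
    by (subst cis_eq_cis_iff) (auto simp: \<phi>_def intro!: exI[of _ "int (i div k)"])
  have "cis ` set xs = cis ` range \<phi>"
  proof (intro equalityI subsetI; clarify)
    fix x assume "x \<in> set xs"
    then obtain i where "i < k" "x = xs ! i" by (auto simp: in_set_conv_nth k_def)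
    then have "cis x = cis (\<phi> i)" using cis[of i] by simp
    then show "cis x \<in> cis ` range \<phi>" by blast
  next
    fix i
    have "xs ! (i mod k) \<in> set xs" using k by (simp add: k_def)
    then show "cis (\<phi> i) \<in> cis ` set xs" using cis by blast
  qed
  then have "angle_lift \<phi> k (cis ` set xs)"
    using k mono by (auto simp: angle_lift_def strict_mono_Suc_iff) (simp_all add: \<phi>_def algebra_simps)
  then show ?thesis by (simp add: \<phi>_def k_def)
qed

text \<open>Sorting the angles that lie in the turn beginning at \<open>a\<close> gives one
  period. Being able to prescribe the base point is what lets the lift of the cut points be
  compared with that of the half-crossings.\<close>

lemma finite_angle_lift_from:
  assumes "finite P" "P \<subseteq> circle" "cis a \<in> P"
  obtains \<phi> where "angle_lift \<phi> (card P) P" "\<phi> 0 = a"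
proof -
  define A where "A = {x. a \<le> x \<and> x < a + 2 * pi \<and> cis x \<in> P}"
  have inj: "inj_on cis A"
    by (rule inj_onI, rule cis_inj_within_turn) (auto simp: A_def)
  have im: "cis ` A = P"
  proof (intro equalityI subsetI)
    fix z assume "z \<in> P"
    then obtain x where "a \<le> x" "x < a + 2 * pi" "z = cis x"
      using assms(2) circle_angle_in_turn by blast
    with \<open>z \<in> P\<close> show "z \<in> cis ` A" by (auto simp: A_def)
  qed (auto simp: A_def)
  have fin: "finite A" using inj im assms(1) finite_image_iff by blast
  have "a \<in> A" using assms(3) by (simp add: A_def)
  define xs where "xs = sorted_list_of_set A"
  have set: "set xs = A" using fin by (simp add: xs_def)
  have ne: "xs \<noteq> []" using set \<open>a \<in> A\<close> by auto
  have "Min A = a" using fin \<open>a \<in> A\<close> by (intro Min_eqI) (auto simp: A_def)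
  then have hd: "hd xs = a"
    unfolding xs_def by (metis \<open>a \<in> A\<close> empty_iff fin list.sel(1) sorted_list_of_set_nonempty)
  have "length xs = card P"
    using card_image[OF inj] im by (simp add: xs_def)
  moreover have "angle_lift (\<lambda>i. xs ! (i mod length xs) + 2 * pi * real (i div length xs))
           (length xs) (cis ` set xs)"
    by (rule angle_lift_of_list) (use ne hd set in \<open>auto simp: A_def xs_def\<close>)
  ultimately show ?thesis
    using that[of "\<lambda>i. xs ! (i mod length xs) + 2 * pi * real (i div length xs)"]
      set im hd ne by (simp add: hd_conv_nth)
qed

section \<open>Components of the complement of finitely many points\<close>

lemma open_arc_no_lift_points:
  assumes L: "angle_lift \<phi> k P" and "\<phi> i < x" "x < \<phi> (Suc i)"
  shows "cis x \<notin> P"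
proof
  assume "cis x \<in> P"
  moreover have "\<phi> 0 \<le> x" using assms angle_lift_le_iff[OF L, of 0 i] by simp
  ultimately obtain j where "x = \<phi> j" using angle_lift_range[OF L] by blast
  then show False using assms(2,3) angle_lift_less_iff[OF L] by simp
qed

text \<open>The open arc is connected. It is also clopen in any larger subset \<open>T\<close>
  of the complement: it is the trace on \<open>T\<close> of the compact closed arc with the same
  ends, since these ends lie in \<open>P\<close>, and it is the trace of the complement of the
  compact opposite arc. A connected \<open>T\<close> is therefore equal to it.\<close>

lemma open_arc_in_components:
  assumes L: "angle_lift \<phi> k P"
  shows "cis ` {\<phi> i<..<\<phi> (Suc i)} \<in> components (circle - P)"
proof -
  define a b where "a = \<phi> i" and "b = \<phi> (Suc i)"
  define A where "A = cis ` {a<..<b}"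
  have ab: "a < b" "b \<le> a + 2 * pi" "cis a \<in> P" "cis b \<in> P"
    using angle_lift_less_iff[OF L] angle_lift_Suc_le_turn[OF L] cis_angle_lift_in[OF L]
    by (auto simp: a_def b_def)
  have ne: "A \<noteq> {}" using ab by (simp add: A_def)
  have sub: "A \<subseteq> circle - P"
    using open_arc_no_lift_points[OF L] by (auto simp: A_def a_def b_def)
  have "connected A"
    unfolding A_def by (intro connected_continuous_image continuous_intros connected_Ioo)
  moreover have "T = A" if T: "A \<subseteq> T" "T \<subseteq> circle - P" "connected T" for T
  proof -
    have "compact (cis ` {a..b})" "compact (cis ` {b..a + 2 * pi})"
      by (intro compact_continuous_image continuous_intros compact_Icc)+
    then have closed: "closed (cis ` {a..b})" "closed (cis ` {b..a + 2 * pi})"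
      by (auto intro: compact_imp_closed)
    have "A = T \<inter> cis ` {a..b}"
    proof (intro equalityI subsetI)
      fix z assume z: "z \<in> T \<inter> cis ` {a..b}"
      then obtain x where "z = cis x" "a \<le> x" "x \<le> b" by auto
      moreover have "x \<noteq> a" "x \<noteq> b" using z T(2) ab calculation(1) by blast+
      ultimately show "z \<in> A" by (simp add: A_def)
    qed (use T(1) in \<open>auto simp: A_def\<close>)
    then have "closedin (top_of_set T) A"
      using closed(1) closedin_closed by blast
    moreover have "A = T \<inter> - cis ` {b..a + 2 * pi}"
    proof (intro equalityI subsetI)
      fix z assume "z \<in> A"
      then obtain x where x: "z = cis x" "a < x" "x < b" by (auto simp: A_def)
      have "cis x \<noteq> cis y" if "b \<le> y" "y \<le> a + 2 * pi" for y
        using cis_inj_within_turn[of x y] that x(2,3) by auto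
      then have "z \<notin> cis ` {b..a + 2 * pi}"
        unfolding x(1) by fastforce
      then show "z \<in> T \<inter> - cis ` {b..a + 2 * pi}"
        using \<open>z \<in> A\<close> T(1) by blast
    next
      fix z assume z: "z \<in> T \<inter> - cis ` {b..a + 2 * pi}"
      then obtain x where x: "a \<le> x" "x < a + 2 * pi" "z = cis x"
        using T(2) circle_angle_in_turn[of z a] by blast
      moreover have "x \<noteq> a" using z T(2) ab(3) x(3) by blast
      moreover have "x < b"
      proof (rule ccontr)
        assume "\<not> x < b"
        then have "x \<in> {b..a + 2 * pi}" using x(2) by simp
        then show False using z x(3) by blast
      qed
      ultimately show "z \<in> A" by (simp add: A_def)
    qed
    then have "openin (top_of_set T) A"
      using closed(2) by (metis open_Compl openin_open_Int)
    ultimately show "T = A"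
      using T(3) ne unfolding connected_clopen by blast
  qed
  ultimately have "A \<in> components (circle - P)"
    unfolding in_components_maximal using ne sub by blast
  then show ?thesis by (simp add: A_def a_def b_def)
qed

lemma components_minus_lift:
  assumes L: "angle_lift \<phi> k P"
  shows "components (circle - P) = (\<lambda>i. cis ` {\<phi> i<..<\<phi> (Suc i)}) ` {..<k}" (is "_ = ?A ` _")
    and "card (components (circle - P)) = k"
proof -
  have cover: "\<exists>i<k. z \<in> ?A i" if z: "z \<in> circle - P" for z
  proof -
    obtain x where x: "\<phi> 0 \<le> x" "x < \<phi> 0 + 2 * pi" "z = cis x"
      using z circle_angle_in_turn[of z "\<phi> 0"] by blast
    then obtain i where i: "\<phi> i \<le> x" "x < \<phi> (Suc i)"
      using angle_lift_bracket[OF L] by blast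
    have "\<phi> i < \<phi> (0 + k)" using i x angle_lift_turn[OF L, of 0] by simp
    then have "i < k" using angle_lift_less_iff[OF L] by simp
    moreover have "x \<noteq> \<phi> i" using z x(3) cis_angle_lift_in[OF L] by blast
    ultimately show ?thesis using i x(3) by auto
  qed
  show eq: "components (circle - P) = ?A ` {..<k}"
  proof (intro equalityI subsetI)
    fix c assume c: "c \<in> components (circle - P)"
    then obtain z where z: "z \<in> c" "z \<in> circle - P"
      using in_components_nonempty in_components_subset by blast
    then obtain i where "i < k" "z \<in> ?A i" using cover by blast
    then have "c = ?A i"
      using components_nonoverlap[OF c open_arc_in_components[OF L, of i]] z by blast
    with \<open>i < k\<close> show "c \<in> ?A ` {..<k}" by blast
  qed (use open_arc_in_components[OF L] in auto)
  have "?A i \<noteq> ?A j" if ij: "i < j" "j < k" for i j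
  proof
    assume "?A i = ?A j"
    moreover obtain x where x: "\<phi> i < x" "x < \<phi> (Suc i)"
      using angle_lift_less_iff[OF L, of i "Suc i"] dense by blast
    ultimately obtain y where y: "\<phi> j < y" "y < \<phi> (Suc j)" "cis x = cis y"
      by (smt (verit) greaterThanLessThan_iff imageE imageI)
    have "\<phi> (Suc i) \<le> \<phi> j" "\<phi> (Suc j) \<le> \<phi> (i + k)"
      using angle_lift_le_iff[OF L] ij by auto
    then show False
      using cis_inj_within_turn[OF y(3)] x y(1,2) angle_lift_turn[OF L, of i] by auto
  qed
  then have "inj_on ?A {..<k}"
    by (intro inj_onI) (metis lessThan_iff nat_neq_iff)
  then show "card (components (circle - P)) = k"
    unfolding eq by (simp add: card_image)
qed

section \<open>Embedded partitions\<close>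

text \<open>Without cut points the only component is the whole circle, which is not a regular
  arc because an open arc misses its own starting point.\<close>

lemma embedded_partition_nonempty:
  assumes "embedded_partition D P"
  shows "P \<noteq> {}"
proof
  assume "P = {}"
  moreover have "components circle = {circle}"
    unfolding components_eq_sing_iff using connected_sphere[of "0::complex" 1] by auto
  ultimately have "regular_arc D circle"
    using assms by (simp add: embedded_partition_def)
  then obtain a b where ab: "a < b" "b \<le> a + 2 * pi" "circle = cis ` {a<..<b}"
    by (auto simp: regular_arc_def)
  have "cis a \<in> circle" by simp
  then obtain x where "cis a = cis x" "a < x" "x < b" using ab(3) by auto
  then show False using cis_inj_within_turn[of a x] ab by auto
qed

text \<open>The components are regular arcs automatically: their ends are cut points, and
  consecutive angles of the lift differ by at most a full turn.\<close>

lemma embedded_partition_iff_lift: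
  assumes L: "angle_lift \<phi> k P" and "finite P" "P \<subseteq> regular_points D"
  shows "embedded_partition D P \<longleftrightarrow> (\<forall>i<k. properly_embedded D (cis ` {\<phi> i<..<\<phi> (Suc i)}))"
proof -
  have "regular_arc D (cis ` {\<phi> i<..<\<phi> (Suc i)})" for i
    unfolding regular_arc_def
    using angle_lift_less_iff[OF L, of i "Suc i"] angle_lift_Suc_le_turn[OF L, of i]
      cis_angle_lift_in[OF L] assms(3) by blast
  then show ?thesis
    using assms(2,3) by (auto simp: embedded_partition_def components_minus_lift(1)[OF L])
qed

lemma card_components_minus_finite:
  assumes "finite P" "P \<noteq> {}" "P \<subseteq> circle"
  shows "card (components (circle - P)) = card P"
proof -
  obtain z where z: "z \<in> P" using assms(2) by blast
  obtain a where "z = cis a" using circle_angle_in_turn[of z 0] z assms(3) by blast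
  then obtain \<phi> where "angle_lift \<phi> (card P) P"
    using finite_angle_lift_from[of P a] assms z by blast
  then show ?thesis by (rule components_minus_lift(2))
qed

lemma arc_number_eqI:
  assumes P: "embedded_partition D P" "card P = k"
    and least: "\<And>Q. embedded_partition D Q \<Longrightarrow> k \<le> card Q"
  shows "arc_number D = k"
proof -
  have card: "card (components (circle - Q)) = card Q" if "embedded_partition D Q" for Q
    using that embedded_partition_nonempty[OF that]
    by (intro card_components_minus_finite) (auto simp: embedded_partition_def regular_points_def)
  show ?thesis
    unfolding arc_number_def
  proof (rule Least_equality)
    show "\<exists>P. embedded_partition D P \<and> k = card (components (circle - P))"
      using P card by metis
  next
    fix j assume "\<exists>Q. embedded_partition D Q \<and> j = card (components (circle - Q))"
    then show "k \<le> j" using card least by auto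
  qed
qed

section \<open>Greedy cutting\<close>

text \<open>Positions are indices into the periodic enumeration of the half-crossings; position
  \<open>k\<close> belongs to the half-crossing \<open>k mod length ps\<close>.\<close>

definition partners :: "nat list \<Rightarrow> nat \<Rightarrow> nat \<Rightarrow> bool" where
  "partners ps q k \<longleftrightarrow> q mod length ps = ps ! (k mod length ps)"

text \<open>The cuts made by the greedy walk that starts with a cut just before position
  \<open>s\<close> and has passed \<open>i\<close> half-crossings, latest cut first. A cut is
  recorded as the position that follows it. A new cut before position \<open>s + i\<close> is
  made exactly if passing it would complete a crossing within the current arc.\<close>

fun greedy_cuts :: "nat list \<Rightarrow> nat \<Rightarrow> nat \<Rightarrow> nat list" where
  "greedy_cuts ps s 0 = [s]"
| "greedy_cuts ps s (Suc i) =
     (let cs = greedy_cuts ps s i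
      in if \<exists>q. hd cs \<le> q \<and> q < s + i \<and> partners ps q (s + i) then (s + i) # cs else cs)"

definition greedy_arcs :: "nat list \<Rightarrow> nat \<Rightarrow> nat" where
  "greedy_arcs ps s = length (greedy_cuts ps s (length ps))"

lemma greedy_cuts_nonempty: "greedy_cuts ps s i \<noteq> []"
  by (induction i) (auto simp: Let_def)

lemma start_in_greedy_cuts: "s \<in> set (greedy_cuts ps s i)"
  by (induction i) (auto simp: Let_def)

text \<open>The maximum accounts for the initial cut at \<open>s\<close>, which is present
  before the first step.\<close>

lemma greedy_cuts_range: "set (greedy_cuts ps s i) \<subseteq> {s..<s + max 1 i}"
  by (induction i) (force simp: Let_def split: if_splits)+

lemma hd_greedy_cuts_range: "hd (greedy_cuts ps s i) \<in> {s..<s + max 1 i}"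
  using greedy_cuts_range greedy_cuts_nonempty hd_in_set by blast

text \<open>No cut is repeated at the very first step: the arc is still empty there, so no
  crossing can be completed.\<close>

lemma distinct_greedy_cuts: "distinct (greedy_cuts ps s i)"
proof (induction i)
  case (Suc i)
  have "s + i \<notin> set (greedy_cuts ps s i)" if "hd (greedy_cuts ps s i) < s + i"
  proof -
    have "i \<noteq> 0" using that by (cases i) auto
    then show ?thesis using greedy_cuts_range[of ps s i] by auto
  qed
  with Suc show ?case by (auto simp: Let_def)
qed simp

text \<open>When the walk reaches the later partner \<open>k\<close>, either the last cut
  already lies after \<open>q\<close>, or \<open>q\<close> is in the current arc and the walk
  cuts before \<open>k\<close>.\<close>

lemma greedy_cuts_separate_partners:
  assumes "partners ps q k" "s \<le> q" "q < k" "k < s + i"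
  shows "\<exists>c\<in>set (greedy_cuts ps s i). q < c \<and> c \<le> k"
  using assms
proof (induction i)
  case (Suc i)
  let ?cs = "greedy_cuts ps s i"
  show ?case
  proof (cases "k < s + i")
    case True
    then show ?thesis using Suc by (auto simp: Let_def)
  next
    case False
    then have k: "k = s + i" using Suc.prems by simp
    show ?thesis
    proof (cases "hd ?cs \<le> q")
      case True
      then show ?thesis using k Suc.prems by (auto simp: Let_def)
    next
      case False
      have "hd ?cs \<in> set ?cs" "hd ?cs \<le> k"
        using greedy_cuts_nonempty hd_greedy_cuts_range[of ps s i] k Suc.prems
        by (auto simp: max_def split: if_splits)
      with False show ?thesis by (auto simp: Let_def intro!: bexI[of _ "hd ?cs"])
    qed
  qed
qed simp

lemma greedy_arcs_le:
  assumes "ps \<noteq> []"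
  shows "greedy_arcs ps s \<le> length ps"
proof -
  have "greedy_arcs ps s = card (set (greedy_cuts ps s (length ps)))"
    by (simp add: greedy_arcs_def distinct_card distinct_greedy_cuts)
  also have "\<dots> \<le> card {s..<s + max 1 (length ps)}"
    by (intro card_mono greedy_cuts_range) simp
  also have "\<dots> = length ps" using assms by (cases ps) auto
  finally show ?thesis .
qed

section \<open>The greedy minimum is the arc number\<close>

lemma angle_lift_of_enumeration:
  assumes "cyclic_enumeration D hs" "hs \<noteq> []"
  obtains \<Theta> where "angle_lift \<Theta> (length hs) (half_crossings D)"
    and "\<And>i. cis (\<Theta> i) = hs ! (i mod length hs)"
proof -
  obtain \<theta>s where \<theta>s: "hs = map cis \<theta>s" "sorted_wrt (<) \<theta>s" "\<forall>\<theta>\<in>set \<theta>s. \<theta> < hd \<theta>s + 2 * pi"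
    and H: "set hs = half_crossings D"
    using assms(1) by (auto simp: cyclic_enumeration_def)
  define \<Theta> where "\<Theta> = (\<lambda>i. \<theta>s ! (i mod length \<theta>s) + 2 * pi * real (i div length \<theta>s))"
  have "angle_lift \<Theta> (length \<theta>s) (cis ` set \<theta>s)"
    unfolding \<Theta>_def by (rule angle_lift_of_list) (use \<theta>s assms(2) in auto)
  moreover have "cis ` set \<theta>s = half_crossings D"
    using H \<theta>s(1) by simp
  moreover have "cis (\<Theta> i) = hs ! (i mod length hs)" for i
  proof -
    have "cis (\<Theta> i) = cis (\<theta>s ! (i mod length \<theta>s))"
      by (subst cis_eq_cis_iff) (auto simp: \<Theta>_def intro!: exI[of _ "int (i div length \<theta>s)"])
    then show ?thesis using \<theta>s(1) assms(2) by simp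
  qed
  ultimately show ?thesis using that \<theta>s(1) by simp
qed

text \<open>The lift forces \<open>ps\<close> to be nonempty, so this describes the diagrams
  that have a crossing.\<close>

locale presented_diagram =
  fixes D :: chord_diagram and hs :: "complex list" and ps :: "nat list" and \<Theta> :: "nat \<Rightarrow> real"
  assumes diagram: "is_chord_diagram D"
    and table: "partner_table D hs ps"
    and lift: "angle_lift \<Theta> (length ps) (half_crossings D)"
    and cis_lift: "\<And>i. cis (\<Theta> i) = hs ! (i mod length ps)"
begin

lemma length_pos: "0 < length ps"
  using lift by (simp add: angle_lift_def)

lemma half_crossing_not_regular: "cis (\<Theta> i) \<notin> regular_points D"
  using cis_angle_lift_in[OF lift] by (simp add: regular_points_def)

lemma crossing_of_partners:
  assumes "partners ps q k"
  shows "{cis (\<Theta> k), cis (\<Theta> q)} \<in> crossings D"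
proof -
  have "k mod length ps < length hs"
    using table length_pos by (simp add: partner_table_def)
  then show ?thesis
    using table assms by (simp add: partner_table_def partners_def cis_lift)
qed

text \<open>Crossings are disjoint, so the crossing containing the half-crossing at
  \<open>k\<close> is the one given by the partner table, and its other element determines an
  index below \<open>length ps\<close>, as distinct angles within one turn give distinct
  points.\<close>

lemma partners_of_crossing:
  assumes x: "x \<in> crossings D" "cis (\<Theta> q) \<in> x" "cis (\<Theta> k) \<in> x" and ne: "cis (\<Theta> q) \<noteq> cis (\<Theta> k)"
  shows "partners ps q k"
proof -
  define p where "p = ps ! (k mod length ps)"
  have "k mod length ps < length hs"
    using table length_pos by (simp add: partner_table_def)
  then have p: "p < length ps"
    using table by (simp add: partner_table_def p_def)
  have "partners ps p k" using p by (simp add: partners_def p_def)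
  then have y: "{cis (\<Theta> k), cis (\<Theta> p)} \<in> crossings D" (is "?y \<in> _") by (rule crossing_of_partners)
  have "disjoint (crossings D)"
    using diagram by (simp add: is_chord_diagram_def partition_on_def)
  then have "x \<inter> ?y = {}" if "x \<noteq> ?y"
    using disjointD x(1) y that by meson
  then have xy: "x = ?y" using x(3) by (metis disjoint_iff insertI1)
  have "cis (\<Theta> q) = cis (\<Theta> p)" using x(2) ne unfolding xy by simp
  then have "cis (\<Theta> (q mod length ps)) = cis (\<Theta> p)"
    by (simp add: cis_lift)
  moreover have "\<bar>\<Theta> (q mod length ps) - \<Theta> p\<bar> < 2 * pi"
  proof -
    have "\<Theta> i < \<Theta> 0 + 2 * pi" "\<Theta> 0 \<le> \<Theta> i" if "i < length ps" for i
      using that angle_lift_turn[OF lift, of 0] angle_lift_less_iff[OF lift, of i "0 + length ps"]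
        angle_lift_le_iff[OF lift, of 0 i] by auto
    from this[of p] this[of "q mod length ps"] p length_pos show ?thesis by (simp add: abs_less_iff)
  qed
  ultimately have "\<Theta> (q mod length ps) = \<Theta> p" by (rule cis_inj_within_turn)
  then have "q mod length ps = p"
    using lift by (simp add: angle_lift_def strict_mono_eq)
  then show ?thesis by (simp add: partners_def p_def)
qed

text \<open>The greedy cuts are realised by cut points half-way between the half-crossing before
  and the one after the cut. One turn of the walk covers exactly the half-crossings met between
  the first cut point and its return, so two partners within one arc would be positions \<open>q
  < k\<close> of the walk not separated by a cut. A start \<open>s > 0\<close> ensures that the
  position preceding a cut exists.\<close>

lemma greedy_embedded_partition:
  assumes s: "0 < s"
  obtains P where "embedded_partition D P" "card P = greedy_arcs ps s"
proof -
  define m where "m = length ps"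
  define C where "C = set (greedy_cuts ps s m)"
  define \<mu> where "\<mu> = (\<lambda>c. (\<Theta> (c - 1) + \<Theta> c) / 2)"
  define P where "P = cis ` \<mu> ` C"
  have m: "0 < m" using length_pos by (simp add: m_def)
  have C: "C \<subseteq> {s..<s + m}" "s \<in> C"
    using greedy_cuts_range[of ps s m] start_in_greedy_cuts m by (auto simp: C_def max_def)
  have \<mu>: "\<Theta> (c - 1) < \<mu> c" "\<mu> c < \<Theta> c" if "s \<le> c" for c
    using angle_lift_less_iff[OF lift, of "c - 1" c] that s by (auto simp: \<mu>_def)
  have \<mu>_mono: "\<mu> c < \<mu> d" if "s \<le> c" "c < d" for c d
    using \<mu>(2)[of c] \<mu>(1)[of d] angle_lift_le_iff[OF lift, of c "d - 1"] that by fastforce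
  have \<mu>_turn: "\<mu> (s + m) = \<mu> s + 2 * pi"
    using angle_lift_turn[OF lift, of "s - 1"] angle_lift_turn[OF lift, of s] s
    by (simp add: \<mu>_def m_def)
  have \<mu>_eq: "c = d" if "c \<in> C" "d \<in> C" "cis (\<mu> c) = cis (\<mu> d)" for c d
  proof -
    have "\<mu> s \<le> \<mu> e" "\<mu> e < \<mu> s + 2 * pi" if "e \<in> C" for e
      using that C \<mu>_mono[of s e] \<mu>_mono[of e "s + m"] \<mu>_turn by (cases "e = s"; force)+
    from this[of c] this[of d] that have "\<mu> c = \<mu> d"
      by (intro cis_inj_within_turn) auto
    moreover have "s \<le> c" "s \<le> d" using that C by auto
    ultimately show ?thesis using \<mu>_mono by (metis less_irrefl nat_neq_iff)
  qed
  then have "card P = card C"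
    unfolding P_def image_image by (intro card_image inj_onI)
  then have cardP: "card P = greedy_arcs ps s"
    by (simp add: C_def m_def greedy_arcs_def distinct_card distinct_greedy_cuts)
  have regular: "cis (\<mu> c) \<notin> half_crossings D" if "s \<le> c" for c
    using open_arc_no_lift_points[OF lift, of "c - 1" "\<mu> c"] \<mu>[OF that] that s by simp
  have P_regular: "P \<subseteq> regular_points D" "finite P"
    using C regular by (auto simp: P_def regular_points_def C_def)
  then have circle: "P \<subseteq> circle" by (auto simp: regular_points_def)
  have "cis (\<mu> s) \<in> P" using C by (simp add: P_def)
  then obtain \<phi> where \<phi>: "angle_lift \<phi> (card P) P" "\<phi> 0 = \<mu> s"
    using finite_angle_lift_from P_regular(2) circle by blast
  \<comment> \<open>Half-crossings inside an arc are positions that the walk passes, counted from \<open>s\<close>.\<close>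
  have position: "\<exists>q. u = \<Theta> q \<and> s \<le> q \<and> q < s + m"
    if u: "\<phi> i < u" "u < \<phi> (Suc i)" "i < card P" "cis u \<in> half_crossings D" for u i
  proof -
    have "\<phi> (Suc i) \<le> \<phi> (0 + card P)" "\<phi> 0 \<le> \<phi> i"
      using u(3) angle_lift_le_iff[OF \<phi>(1)] by simp_all
    then have "\<mu> s < u" "u < \<mu> (s + m)"
      using u(1,2) \<mu>_turn \<phi> angle_lift_turn[OF \<phi>(1), of 0] by auto
    then have bounds: "\<Theta> (s - 1) < u" "u < \<Theta> (s + m)" using \<mu>[of s] \<mu>[of "s + m"] by auto
    then have "\<Theta> 0 \<le> u" using angle_lift_le_iff[OF lift, of 0 "s - 1"] by simp
    then obtain q where q: "u = \<Theta> q" using angle_lift_range[OF lift] u(4) by blast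
    then have "s - 1 < q" "q < s + m"
      using bounds angle_lift_less_iff[OF lift] by auto
    with q show ?thesis by auto
  qed
  have separated: False
    if i: "i < card P" and q: "\<phi> i < \<Theta> q" "s \<le> q" and k: "\<Theta> k < \<phi> (Suc i)" "k < s + m"
      and qk: "q < k" "partners ps q k" for i q k
  proof -
    obtain c where c: "c \<in> C" "q < c" "c \<le> k"
      using greedy_cuts_separate_partners[OF qk(2) q(2) qk(1) k(2)] by (auto simp: C_def)
    have "s \<le> c" using c(1) C by auto
    have "\<Theta> q \<le> \<Theta> (c - 1)" "\<Theta> c \<le> \<Theta> k"
      using c angle_lift_le_iff[OF lift] by auto
    then have "\<phi> i < \<mu> c" "\<mu> c < \<phi> (Suc i)" using \<mu>[OF \<open>s \<le> c\<close>] q k by auto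
    then have "cis (\<mu> c) \<notin> P" by (rule open_arc_no_lift_points[OF \<phi>(1)])
    then show False using c(1) by (simp add: P_def)
  qed
  have "properly_embedded D (cis ` {\<phi> i<..<\<phi> (Suc i)})" if i: "i < card P" for i
    unfolding properly_embedded_def
  proof
    assume "\<exists>x\<in>crossings D. x \<subseteq> cis ` {\<phi> i<..<\<phi> (Suc i)}"
    then obtain x where x: "x \<in> crossings D" "x \<subseteq> cis ` {\<phi> i<..<\<phi> (Suc i)}" by blast
    have "card x = 2" "x \<subseteq> half_crossings D"
      using diagram x(1) by (auto simp: is_chord_diagram_def partition_on_def)
    then obtain y z where yz: "x = {y, z}" "y \<noteq> z" "y \<in> half_crossings D" "z \<in> half_crossings D"
      by (auto simp: card_2_iff)
    then obtain u v where uv: "y = cis u" "\<phi> i < u" "u < \<phi> (Suc i)" "z = cis v" "\<phi> i < v" "v < \<phi> (Suc i)"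
      using x(2) by auto
    obtain q where q: "u = \<Theta> q" "s \<le> q" "q < s + m"
      using position[OF uv(2,3) i] yz uv by blast
    obtain k where k: "v = \<Theta> k" "s \<le> k" "k < s + m"
      using position[OF uv(5,6) i] yz uv by blast
    have "partners ps q k" "partners ps k q"
      by (rule partners_of_crossing[OF x(1)]; use yz uv q k in simp)+
    moreover have "q \<noteq> k" using yz(2) uv q k by auto
    ultimately show False
      using separated[OF i, of q k] separated[OF i, of k q] uv q k by (metis nat_neq_iff)
  qed
  then have "embedded_partition D P"
    using embedded_partition_iff_lift[OF \<phi>(1)] P_regular by simp
  then show ?thesis using that cardP by blast
qed

text \<open>Among all walks, start one at the first half-crossing after a point of the given
  partition. It never falls behind that partition: the arc of the walk that begins after cut
  point \<open>\<phi> l\<close> cannot be ended before \<open>\<phi> (Suc l)\<close>, since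
  ending it means that a crossing is completed, and this crossing would lie between two
  consecutive cut points. Hence after one turn the walk has made at most as many cuts as the
  partition. The start is taken in the second turn, so that there is a position before
  \<open>s\<close>.\<close>

lemma greedy_lower_bound:
  assumes P: "embedded_partition D P"
  obtains s where "length ps \<le> s" "s < 2 * length ps" "greedy_arcs ps s \<le> card P"
proof -
  define m where "m = length ps"
  have m: "0 < m" using length_pos by (simp add: m_def)
  have turn: "\<Theta> (i + m) = \<Theta> i + 2 * pi" for i
    unfolding m_def by (rule angle_lift_turn[OF lift])
  have finP: "finite P" and regular: "P \<subseteq> regular_points D"
    using P by (auto simp: embedded_partition_def)
  then have circle: "P \<subseteq> circle" by (auto simp: regular_points_def)
  obtain z where z: "z \<in> P" using embedded_partition_nonempty[OF P] by blast
  then obtain a where a: "\<Theta> (m - 1) \<le> a" "a < \<Theta> (m - 1) + 2 * pi" "z = cis a"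
    using circle circle_angle_in_turn by blast
  obtain \<phi> where \<phi>: "angle_lift \<phi> (card P) P" "\<phi> 0 = a"
    using finite_angle_lift_from[OF finP circle] z a(3) by blast
  have "\<Theta> 0 \<le> a" using a(1) angle_lift_le_iff[OF lift, of 0 "m - 1"] by simp
  then obtain j where j: "\<Theta> j \<le> a" "a < \<Theta> (Suc j)"
    using angle_lift_bracket[OF lift] by blast
  define s where "s = Suc j"
  have "\<Theta> (m - 1) < \<Theta> s" "\<Theta> j < \<Theta> (m - 1 + m)"
    using a(1,2) j turn[of "m - 1"] unfolding s_def by linarith+
  then have "m - 1 < s" "j < m - 1 + m"
    by (simp_all only: angle_lift_less_iff[OF lift])
  then have s: "m \<le> s" "s < 2 * m"
    using m by (auto simp: s_def)
  \<comment> \<open>The greedy cut number \<open>l\<close>, counted from 0, lies beyond \<open>\<phi> l\<close>.\<close>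
  have "\<phi> (length (greedy_cuts ps s i) - 1) < \<Theta> (hd (greedy_cuts ps s i))" for i
  proof (induction i)
    case 0
    then show ?case using \<phi>(2) j by (simp add: s_def)
  next
    case (Suc i)
    let ?cs = "greedy_cuts ps s i" and ?k = "s + i"
    show ?case
    proof (cases "\<exists>q. hd ?cs \<le> q \<and> q < ?k \<and> partners ps q ?k")
      case True
      then obtain q where q: "hd ?cs \<le> q" "q < ?k" "partners ps q ?k" by blast
      obtain l where l: "length ?cs = Suc l"
        using greedy_cuts_nonempty[of ps s i] by (cases "length ?cs") auto
      have less: "\<phi> l < \<Theta> q" "\<Theta> q < \<Theta> ?k"
        using Suc q l angle_lift_le_iff[OF lift, of "hd ?cs" q] angle_lift_less_iff[OF lift] by auto
      have "\<phi> (Suc l) < \<Theta> ?k"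
      proof (rule ccontr)
        assume "\<not> \<phi> (Suc l) < \<Theta> ?k"
        moreover have "\<Theta> ?k \<noteq> \<phi> (Suc l)"
          using cis_angle_lift_in[OF \<phi>(1), of "Suc l"] regular half_crossing_not_regular[of ?k] by auto
        ultimately have "{cis (\<Theta> ?k), cis (\<Theta> q)} \<subseteq> cis ` {\<phi> l<..<\<phi> (Suc l)}"
          using less by auto
        moreover have "properly_embedded D (cis ` {\<phi> l<..<\<phi> (Suc l)})"
          using P open_arc_in_components[OF \<phi>(1), of l] by (auto simp: embedded_partition_def)
        ultimately show False
          using crossing_of_partners[OF q(3)] by (auto simp: properly_embedded_def)
      qed
      then show ?thesis using True l by (simp add: Let_def)
    next
      case False
      then have "greedy_cuts ps s (Suc i) = ?cs" by (simp only: greedy_cuts.simps Let_def if_False)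
      show ?thesis unfolding \<open>greedy_cuts ps s (Suc i) = ?cs\<close> by (rule Suc)
    qed
  qed
  from this[of m] have "\<phi> (greedy_arcs ps s - 1) < \<Theta> (hd (greedy_cuts ps s m))"
    by (simp add: greedy_arcs_def m_def)
  also have "\<dots> \<le> \<Theta> (j + m)"
  proof -
    have "hd (greedy_cuts ps s m) < s + m"
      using hd_greedy_cuts_range[of ps s m] m by (simp add: max_def split: if_splits)
    then show ?thesis by (simp add: angle_lift_le_iff[OF lift] s_def)
  qed
  also have "\<dots> \<le> \<phi> (0 + card P)"
    using turn[of j] j(1) \<phi>(2) angle_lift_turn[OF \<phi>(1), of 0] by linarith
  finally have "greedy_arcs ps s - 1 < card P"
    using angle_lift_less_iff[OF \<phi>(1)] by simp
  then have "greedy_arcs ps s \<le> card P" by linarith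
  then show ?thesis by (rule that[OF s[unfolded m_def]])
qed

end

text \<open>The minimum over the first \<open>i\<close> starts of the second turn. The extra
  candidate \<open>Suc (length ps)\<close> is larger than every greedy count if there is a
  half-crossing; if there is none, it is 1, the arc number of the empty diagram. So no case
  distinction is left for the program.\<close>

definition least_greedy :: "nat list \<Rightarrow> nat \<Rightarrow> nat" where
  "least_greedy ps i = Min (insert (Suc (length ps)) (greedy_arcs ps ` {length ps..<length ps + i}))"

lemma least_greedy_0: "least_greedy ps 0 = Suc (length ps)"
  by (simp add: least_greedy_def)

lemma least_greedy_Suc:
  "least_greedy ps (Suc i) = min (greedy_arcs ps (length ps + i)) (least_greedy ps i)"
proof -
  have "insert (Suc (length ps)) (greedy_arcs ps ` {length ps..<length ps + Suc i}) =
    insert (greedy_arcs ps (length ps + i))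
      (insert (Suc (length ps)) (greedy_arcs ps ` {length ps..<length ps + i}))"
    by (simp add: atLeastLessThanSuc insert_commute)
  then show ?thesis by (simp add: least_greedy_def)
qed

lemma (in presented_diagram) arc_number_eq_least_greedy:
  "arc_number D = least_greedy ps (length ps)"
proof -
  let ?S = "insert (Suc (length ps)) (greedy_arcs ps ` {length ps..<length ps + length ps})"
  have "greedy_arcs ps (length ps) \<in> ?S" "greedy_arcs ps (length ps) < Suc (length ps)"
    using length_pos greedy_arcs_le[of ps "length ps"] by (auto intro!: imageI)
  then have "Min ?S < Suc (length ps)"
    by (subst Min_less_iff) auto
  moreover have "Min ?S \<in> ?S" by (rule Min_in) auto
  ultimately obtain s where s: "length ps \<le> s" "Min ?S = greedy_arcs ps s"
    by (metis atLeastLessThan_iff imageE insertE less_irrefl)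
  then obtain P where P: "embedded_partition D P" "card P = Min ?S"
    using greedy_embedded_partition[of s] length_pos by auto
  moreover have "Min ?S \<le> card Q" if Q: "embedded_partition D Q" for Q
  proof -
    obtain s where s: "length ps \<le> s" "s < 2 * length ps" "greedy_arcs ps s \<le> card Q"
      using greedy_lower_bound[OF Q] .
    have "Min ?S \<le> greedy_arcs ps s" by (rule Min_le) (use s in auto)
    with s(3) show ?thesis by (rule order_trans[rotated])
  qed
  ultimately show ?thesis unfolding least_greedy_def by (rule arc_number_eqI)
qed

text \<open>A single cut suffices, and one cut is needed since the whole circle is not a regular
  arc.\<close>

lemma arc_number_no_half_crossings:
  assumes "is_chord_diagram D" "half_crossings D = {}"
  shows "arc_number D = 1"
proof (rule arc_number_eqI)
  have no: "crossings D = {}"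
    using assms by (auto simp: is_chord_diagram_def partition_on_def)
  have P: "finite {1::complex}" "{1::complex} \<subseteq> circle" "cis 0 \<in> {1::complex}" by auto
  obtain \<phi> where "angle_lift \<phi> (card {1::complex}) {1}"
    using finite_angle_lift_from[OF P] by blast
  then show "embedded_partition D {1}"
    using assms(2) no
    by (subst embedded_partition_iff_lift) (auto simp: regular_points_def properly_embedded_def)
  show "1 \<le> card Q" if "embedded_partition D Q" for Q
    using that embedded_partition_nonempty[OF that]
    by (simp add: embedded_partition_def Suc_le_eq card_gt_0_iff)
qed simp

theorem arc_number_eq_least_greedy:
  assumes "is_chord_diagram D" "cyclic_enumeration D hs" "partner_table D hs ps"
  shows "arc_number D = least_greedy ps (length ps)"
proof (cases "hs = []")
  case True
  then have "half_crossings D = {}" "ps = []"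
    using assms by (auto simp: cyclic_enumeration_def partner_table_def)
  then show ?thesis
    using arc_number_no_half_crossings[OF assms(1)] by (simp add: least_greedy_0)
next
  case False
  have len: "length ps = length hs" using assms(3) by (simp add: partner_table_def)
  obtain \<Theta> where "angle_lift \<Theta> (length hs) (half_crossings D)"
    and "\<And>i. cis (\<Theta> i) = hs ! (i mod length hs)"
    by (rule angle_lift_of_enumeration[OF assms(2) False]) (rule that)
  then interpret presented_diagram D hs ps \<Theta>
    using assms len by unfold_locales auto
  show ?thesis by (rule arc_number_eq_least_greedy)
qed

section \<open>Running time of programs\<close>

text \<open>Total correctness with a time bound, as a weakest precondition on the initial
  state.\<close>

definition reaches :: "program \<Rightarrow> state \<Rightarrow> nat \<Rightarrow> (state \<Rightarrow> bool) \<Rightarrow> bool" where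
  "reaches c s T Q \<longleftrightarrow> (\<exists>t s'. exec c s t s' \<and> t \<le> T \<and> Q s')"

lemma reaches_Seq:
  assumes "reaches c1 s T1 Q" "\<And>s'. Q s' \<Longrightarrow> reaches c2 s' T2 Q'"
  shows "reaches (Seq c1 c2) s (T1 + T2) Q'"
  using assms unfolding reaches_def by (meson add_mono exec.Seq)

text \<open>The invariant is indexed by the number of completed iterations, so the same index
  bounds the time.\<close>

lemma reaches_While:
  assumes "I 0 s" and stop: "\<And>s. I N s \<Longrightarrow> \<not> holds b s"
    and step: "\<And>i s. i < N \<Longrightarrow> I i s \<Longrightarrow> holds b s \<and> reaches c s T (I (Suc i))"
  shows "reaches (While b c) s (Suc (N * Suc T)) (I N)"
proof -
  have "reaches (While b c) s (Suc (n * Suc T)) (I N)" if "I (N - n) s" "n \<le> N" for n s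
    using that
  proof (induction n arbitrary: s)
    case 0
    then have "\<not> holds b s" using stop by simp
    then have "exec (While b c) s 1 s" by (rule exec.WhileFalse)
    moreover have "1 \<le> Suc (0 * Suc T)" by simp
    moreover have "I N s" using 0 by simp
    ultimately show ?case unfolding reaches_def by blast
  next
    case (Suc n)
    have "holds b s \<and> reaches c s T (I (Suc (N - Suc n)))"
      using Suc.prems by (intro step) auto
    moreover have "Suc (N - Suc n) = N - n" using Suc.prems by simp
    ultimately obtain t s' where t: "holds b s" "exec c s t s'" "t \<le> T" "I (N - n) s'"
      by (auto simp: reaches_def)
    obtain t' s'' where t': "exec (While b c) s' t' s''" "t' \<le> Suc (n * Suc T)" "I N s''"
      using Suc.IH[OF t(4)] Suc.prems by (auto simp: reaches_def)
    have "exec (While b c) s (1 + t + t') s''" using t(1,2) t'(1) by (rule exec.WhileTrue)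
    moreover have "1 + t + t' \<le> Suc (Suc n * Suc T)" using t(3) t'(2) by simp
    ultimately show ?case using t'(3) unfolding reaches_def by blast
  qed
  from this[of N s] assms(1) show ?thesis by simp
qed

primrec loop_free :: "program \<Rightarrow> bool" where
  "loop_free Skip \<longleftrightarrow> True"
| "loop_free (Const x k) \<longleftrightarrow> True"
| "loop_free (Copy x y) \<longleftrightarrow> True"
| "loop_free (Inc x) \<longleftrightarrow> True"
| "loop_free (Dec x) \<longleftrightarrow> True"
| "loop_free (Load x y) \<longleftrightarrow> True"
| "loop_free (Store x y) \<longleftrightarrow> True"
| "loop_free (Seq c1 c2) \<longleftrightarrow> loop_free c1 \<and> loop_free c2"
| "loop_free (IfElse b c1 c2) \<longleftrightarrow> loop_free c1 \<and> loop_free c2"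
| "loop_free (While b c) \<longleftrightarrow> False"

text \<open>A loop-free program is executed by rewriting, and its size bounds its time; only the
  two loops need invariants. The value on loops is arbitrary.\<close>

fun outcome :: "program \<Rightarrow> state \<Rightarrow> state" where
  "outcome Skip s = s"
| "outcome (Const x k) (R, M) = (R(x := k), M)"
| "outcome (Copy x y) (R, M) = (R(x := R y), M)"
| "outcome (Inc x) (R, M) = (R(x := R x + 1), M)"
| "outcome (Dec x) (R, M) = (R(x := R x - 1), M)"
| "outcome (Load x y) (R, M) = (R(x := M (R y)), M)"
| "outcome (Store x y) (R, M) = (R, M(R x := R y))"
| "outcome (Seq c1 c2) s = outcome c2 (outcome c1 s)"
| "outcome (IfElse b c1 c2) s = (if holds b s then outcome c1 s else outcome c2 s)"
| "outcome (While b c) s = s"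

lemma loop_free_exec:
  assumes "loop_free c"
  shows "\<exists>t\<le>Suc (size c). exec c s t (outcome c s)"
  using assms
proof (induction c arbitrary: s)
  case (Seq c1 c2)
  then obtain t1 t2 where "exec c1 s t1 (outcome c1 s)" "t1 \<le> Suc (size c1)"
    "exec c2 (outcome c1 s) t2 (outcome c2 (outcome c1 s))" "t2 \<le> Suc (size c2)"
    by (metis loop_free.simps(8))
  then show ?case by (intro exI[of _ "t1 + t2"]) (auto intro: exec.Seq)
next
  case (IfElse b c1 c2)
  then obtain t1 t2 where "exec c1 s t1 (outcome c1 s)" "t1 \<le> Suc (size c1)"
    "exec c2 s t2 (outcome c2 s)" "t2 \<le> Suc (size c2)"
    by (metis loop_free.simps(9))
  moreover have "exec (IfElse b c1 c2) s (1 + t1) (outcome c1 s)" if "holds b s"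
    using that calculation(1) by (rule exec.IfTrue)
  moreover have "exec (IfElse b c1 c2) s (1 + t2) (outcome c2 s)" if "\<not> holds b s"
    using that calculation(3) by (rule exec.IfFalse)
  ultimately show ?case
    by (intro exI[of _ "if holds b s then 1 + t1 else 1 + t2"]) auto
next
  case (While b c)
  then show ?case by simp
qed (cases s; force simp del: One_nat_def intro!: exI[of _ 1]
  intro: exec.Skip exec.Const exec.Copy exec.Inc exec.Dec exec.Load exec.Store)+

lemma reaches_loop_free:
  assumes "loop_free c" "Q (outcome c s)"
  shows "reaches c s (Suc (size c)) Q"
  using assms loop_free_exec unfolding reaches_def by blast

section \<open>The program\<close>

text \<open>The machine cannot add, so it keeps positions only modulo \<open>m\<close>. As the
  walk makes at most one turn, comparing residues still decides whether the partner lies in the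
  current arc: \<open>k\<close> is in the same block of length \<open>m\<close> as
  \<open>c\<close> or in the next one, and the residue of \<open>k\<close> is the smaller one
  exactly in the second case.\<close>

lemma cyclic_interval_iff:
  fixes c k p m :: nat
  assumes "c \<le> k" "k < c + m" "p < m"
  shows "(\<exists>q. c \<le> q \<and> q < k \<and> q mod m = p) \<longleftrightarrow>
    (if k mod m < c mod m then c mod m \<le> p \<or> p < k mod m else c mod m \<le> p \<and> p < k mod m)"
    (is "?L \<longleftrightarrow> ?R")
proof -
  define a where "a = c div m"
  have m: "0 < m" using assms by simp
  have c: "c = a * m + c mod m" by (simp add: a_def)
  have cm: "c mod m < m" using m by simp
  have "k div m = a \<or> k div m = Suc a"
  proof -
    have "a \<le> k div m" using assms(1) by (simp add: a_def div_le_mono)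
    moreover have "k div m \<le> (c + m) div m" using assms(2) by (simp add: div_le_mono)
    moreover have "(c + m) div m = Suc a" using m by (simp add: a_def)
    ultimately show ?thesis by linarith
  qed
  then consider "k = a * m + k mod m" | "k = a * m + m + k mod m"
    by (metis add.commute div_mult_mod_eq mult_Suc)
  then show ?thesis
  proof cases
    case 1
    have wrap: "\<not> k mod m < c mod m" using 1 c assms(1) by linarith
    have "?L \<longleftrightarrow> c mod m \<le> p \<and> p < k mod m"
    proof
      assume ?L
      then obtain q where q: "c \<le> q" "q < k" "q mod m = p" by blast
      have "q div m = a"
      proof (rule antisym)
        have "k div m = a" using 1 m by (metis add.right_neutral div_mult_self3 mod_div_trivial less_numeral_extra(3))
        then show "q div m \<le> a" using q(2) div_le_mono[of q k m] by simp
        show "a \<le> q div m" using q(1) by (simp add: a_def div_le_mono)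
      qed
      then have "q = a * m + p" using q(3) by (metis div_mult_mod_eq)
      then show "c mod m \<le> p \<and> p < k mod m" using q 1 c by linarith
    next
      assume "c mod m \<le> p \<and> p < k mod m"
      then show ?L using 1 c assms(3) by (intro exI[of _ "a * m + p"]) auto
    qed
    with wrap show ?thesis by simp
  next
    case 2
    have wrap: "k mod m < c mod m" using 2 c assms(2) by linarith
    have "?L \<longleftrightarrow> c mod m \<le> p \<or> p < k mod m"
    proof
      assume ?L
      then obtain q where q: "c \<le> q" "q < k" "q mod m = p" by blast
      show "c mod m \<le> p \<or> p < k mod m"
      proof (rule ccontr)
        assume "\<not> ?thesis"
        then have p: "p < c mod m" "k mod m \<le> p" by auto
        have q': "q = q div m * m + p" using q(3) by (metis div_mult_mod_eq)
        have "a < q div m"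
        proof (rule ccontr)
          assume "\<not> a < q div m"
          then have "q div m * m \<le> a * m" by simp
          then show False using q' q(1) c p(1) by linarith
        qed
        then have "Suc a * m \<le> q div m * m" by (intro mult_le_mono1) simp
        then show False using q' q(2) 2 p(2) by simp
      qed
    next
      assume "c mod m \<le> p \<or> p < k mod m"
      then show ?L
      proof
        assume "c mod m \<le> p"
        then show ?L using 2 c assms(3) by (intro exI[of _ "a * m + p"]) auto
      next
        assume "p < k mod m"
        have "c \<le> a * m + m + p" using c cm by linarith
        moreover have "a * m + m + p < k" using 2 \<open>p < k mod m\<close> by linarith
        moreover have "(a * m + m + p) mod m = p"
        proof -
          have "a * m + m + p = Suc a * m + p" by simp
          then show ?thesis by (simp only: mod_mult_self3 mod_less assms(3))
        qed
        ultimately show ?L by blast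
      qed
    qed
    with wrap show ?thesis by simp
  qed
qed

definition cut :: program where
  "cut = Seq (Copy 4 3) (Inc 5)"

text \<open>Registers: 0 holds the least count so far, 1 the number \<open>m\<close> of
  half-crossings, 2 the start of the walk, 3 the current half-crossing, 4 the half-crossing
  following the last cut, 5 the number of cuts, 6 the partner of the current half-crossing, 7
  the number of half-crossings passed. The nested tests decide whether the partner belongs to
  the cyclic interval from register 4 up to, but excluding, register 3.\<close>

definition advance :: program where
  "advance =
     Seq (Load 6 3)
    (Seq (IfElse (Less 3 4)
            (IfElse (Less 6 4) (IfElse (Less 6 3) cut Skip) cut)
            (IfElse (Less 6 4) Skip (IfElse (Less 6 3) cut Skip)))
    (Seq (Inc 3)
    (Seq (IfElse (Equal 3 1) (Const 3 0) Skip)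
         (Inc 7))))"

definition start :: program where
  "start = Seq (Copy 3 2) (Seq (Copy 4 2) (Seq (Const 5 1) (Const 7 0)))"

definition finish :: program where
  "finish = Seq (IfElse (Less 5 0) (Copy 0 5) Skip) (Inc 2)"

definition sweep :: program where
  "sweep = Seq start (Seq (While (Less 7 1) advance) finish)"

definition arc_number_program :: program where
  "arc_number_program = Seq (Seq (Copy 1 0) (Inc 0)) (While (Less 2 1) sweep)"

text \<open>The program's start \<open>s\<close> corresponds to the position \<open>length ps +
  s\<close> of the second turn, which has the same residue.\<close>

definition in_sweep :: "nat list \<Rightarrow> nat \<Rightarrow> nat \<Rightarrow> nat \<Rightarrow> state \<Rightarrow> bool" where
  "in_sweep ps b s i \<sigma> \<longleftrightarrow>
     snd \<sigma> = snd (initial_state ps) \<and> fst \<sigma> 0 = b \<and> fst \<sigma> 1 = length ps \<and> fst \<sigma> 2 = s \<and>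
     fst \<sigma> 3 = (length ps + s + i) mod length ps \<and>
     fst \<sigma> 4 = hd (greedy_cuts ps (length ps + s) i) mod length ps \<and>
     fst \<sigma> 5 = length (greedy_cuts ps (length ps + s) i) \<and>
     fst \<sigma> 7 = i"

definition between_sweeps :: "nat list \<Rightarrow> nat \<Rightarrow> state \<Rightarrow> bool" where
  "between_sweeps ps i \<sigma> \<longleftrightarrow>
     snd \<sigma> = snd (initial_state ps) \<and> fst \<sigma> 0 = least_greedy ps i \<and> fst \<sigma> 1 = length ps \<and>
     fst \<sigma> 2 = i"

lemma advance_correct:
  assumes I: "in_sweep ps b s i \<sigma>" and i: "i < length ps"
    and valid: "\<And>j. j < length ps \<Longrightarrow> ps ! j < length ps"
  shows "reaches advance \<sigma> (Suc (size advance)) (in_sweep ps b s (Suc i))"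
proof (rule reaches_loop_free)
  show "loop_free advance" by (simp add: advance_def cut_def)
  define m where "m = length ps"
  define cs where "cs = greedy_cuts ps (m + s) i"
  define c where "c = hd cs"
  define k where "k = m + s + i"
  define p where "p = ps ! (k mod m)"
  have m: "0 < m" using i unfolding m_def by (rule le_less_trans[OF le0])
  have index: "k mod m < length ps" using m unfolding m_def by (rule mod_less_divisor)
  have p: "p < m" using valid[OF index] by (simp add: p_def m_def)
  obtain R where \<sigma>: "\<sigma> = (R, snd (initial_state ps))"
    using I by (cases \<sigma>) (auto simp: in_sweep_def)
  have R: "R 0 = b" "R (Suc 0) = m" "R 2 = s" "R 3 = k mod m" "R 4 = c mod m" "R 5 = length cs" "R 7 = i"
    using I by (simp_all add: in_sweep_def \<sigma> m_def cs_def c_def k_def)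
  have load: "snd (initial_state ps) (k mod m) = p"
    using index by (simp add: initial_state_def p_def)
  have "c \<in> {m + s..<m + s + max 1 i}"
    unfolding c_def cs_def by (rule hd_greedy_cuts_range)
  then have c: "c \<le> k" "k < c + m"
    using i by (auto simp: k_def m_def max_def split: if_splits)
  let ?new = "if k mod m < c mod m then c mod m \<le> p \<or> p < k mod m else c mod m \<le> p \<and> p < k mod m"
  have cuts: "greedy_cuts ps (m + s) (Suc i) = (if ?new then k # cs else cs)"
    unfolding cyclic_interval_iff[OF c p, symmetric]
    by (auto simp: cs_def c_def k_def p_def m_def Let_def partners_def)
  have next_index: "(m + s + Suc i) mod m = (if Suc (k mod m) = m then 0 else Suc (k mod m))"
    by (simp add: k_def mod_Suc)
  show "in_sweep ps b s (Suc i) (outcome advance \<sigma>)"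
    unfolding in_sweep_def m_def[symmetric] cuts next_index
    by (simp add: \<sigma> advance_def cut_def R load not_less c_def[symmetric])
qed

definition sweep_time :: "nat \<Rightarrow> nat" where
  "sweep_time m = Suc (size start) + (Suc (m * Suc (Suc (size advance))) + Suc (size finish))"

lemma sweep_correct:
  assumes I: "between_sweeps ps s \<sigma>" and s: "s < length ps"
    and valid: "\<And>j. j < length ps \<Longrightarrow> ps ! j < length ps"
  shows "reaches sweep \<sigma> (sweep_time (length ps)) (between_sweeps ps (Suc s))"
  unfolding sweep_def sweep_time_def
proof (rule reaches_Seq[where Q = "in_sweep ps (least_greedy ps s) s 0"])
  show "reaches start \<sigma> (Suc (size start)) (in_sweep ps (least_greedy ps s) s 0)"
  proof (rule reaches_loop_free)
    show "loop_free start" by (simp add: start_def)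
    show "in_sweep ps (least_greedy ps s) s 0 (outcome start \<sigma>)"
      using I s by (cases \<sigma>) (simp add: between_sweeps_def in_sweep_def start_def)
  qed
next
  fix \<sigma> assume \<sigma>: "in_sweep ps (least_greedy ps s) s 0 \<sigma>"
  show "reaches (Seq (While (Less 7 1) advance) finish) \<sigma>
    (Suc (length ps * Suc (Suc (size advance))) + Suc (size finish)) (between_sweeps ps (Suc s))"
  proof (rule reaches_Seq[where Q = "in_sweep ps (least_greedy ps s) s (length ps)"])
    show "reaches (While (Less 7 1) advance) \<sigma> (Suc (length ps * Suc (Suc (size advance))))
      (in_sweep ps (least_greedy ps s) s (length ps))"
    proof (rule reaches_While[where I = "in_sweep ps (least_greedy ps s) s", OF \<sigma>])
      fix i \<tau> assume i: "i < length ps" "in_sweep ps (least_greedy ps s) s i \<tau>"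
      then have "holds (Less 7 1) \<tau>" by (cases \<tau>) (simp add: in_sweep_def)
      with advance_correct[OF i(2,1) valid]
      show "holds (Less 7 1) \<tau> \<and>
        reaches advance \<tau> (Suc (size advance)) (in_sweep ps (least_greedy ps s) s (Suc i))" by blast
    next
      fix \<tau> assume "in_sweep ps (least_greedy ps s) s (length ps) \<tau>"
      then show "\<not> holds (Less 7 1) \<tau>" by (cases \<tau>) (simp add: in_sweep_def)
    qed
  next
    fix \<tau> assume \<tau>: "in_sweep ps (least_greedy ps s) s (length ps) \<tau>"
    show "reaches finish \<tau> (Suc (size finish)) (between_sweeps ps (Suc s))"
    proof (rule reaches_loop_free)
      show "loop_free finish" by (simp add: finish_def)
      show "between_sweeps ps (Suc s) (outcome finish \<tau>)"
        using \<tau> by (cases \<tau>)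
          (auto simp: in_sweep_def between_sweeps_def finish_def least_greedy_Suc greedy_arcs_def min_def)
    qed
  qed
qed

definition run_time :: "nat \<Rightarrow> nat" where
  "run_time m = Suc (size (Seq (Copy 1 0) (Inc 0))) + Suc (m * Suc (sweep_time m))"

lemma arc_number_program_correct:
  assumes valid: "\<And>j. j < length ps \<Longrightarrow> ps ! j < length ps"
  shows "reaches arc_number_program (initial_state ps) (run_time (length ps))
    (\<lambda>\<sigma>. result \<sigma> = least_greedy ps (length ps))"
  unfolding arc_number_program_def run_time_def
proof (rule reaches_Seq[where Q = "between_sweeps ps 0"])
  show "reaches (Seq (Copy 1 0) (Inc 0)) (initial_state ps) (Suc (size (Seq (Copy 1 0) (Inc 0))))
    (between_sweeps ps 0)"
    by (rule reaches_loop_free) (simp_all add: between_sweeps_def initial_state_def least_greedy_0)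
next
  fix \<sigma> assume \<sigma>: "between_sweeps ps 0 \<sigma>"
  have "reaches (While (Less 2 1) sweep) \<sigma> (Suc (length ps * Suc (sweep_time (length ps))))
    (between_sweeps ps (length ps))"
  proof (rule reaches_While[where I = "between_sweeps ps", OF \<sigma>])
    fix i \<tau> assume i: "i < length ps" "between_sweeps ps i \<tau>"
    then have "holds (Less 2 1) \<tau>" by (cases \<tau>) (simp add: between_sweeps_def)
    with sweep_correct[OF i(2,1) valid]
    show "holds (Less 2 1) \<tau> \<and>
      reaches sweep \<tau> (sweep_time (length ps)) (between_sweeps ps (Suc i))" by blast
  next
    fix \<tau> assume "between_sweeps ps (length ps) \<tau>"
    then show "\<not> holds (Less 2 1) \<tau>" by (cases \<tau>) (simp add: between_sweeps_def)
  qed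
  then show "reaches (While (Less 2 1) sweep) \<sigma> (Suc (length ps * Suc (sweep_time (length ps))))
    (\<lambda>\<sigma>. result \<sigma> = least_greedy ps (length ps))"
    by (auto simp: reaches_def between_sweeps_def result_def)
qed

lemma run_time_quadratic: "(\<lambda>n. real (run_time (2 * n))) \<in> O(\<lambda>n. real n ^ 2)"
proof -
  define a b d where "a = Suc (Suc (size advance))"
    and "b = size start + size finish + 4" and "d = size (Seq (Copy 1 0) (Inc 0)) + 2"
  have "run_time (2 * n) \<le> (4 * a + 2 * b + d) * n ^ 2" if "1 \<le> n" for n
  proof -
    have "run_time (2 * n) = 4 * a * n ^ 2 + 2 * b * n + d"
      by (simp add: run_time_def sweep_time_def a_def b_def d_def power2_eq_square algebra_simps)
    moreover have "n \<le> n ^ 2" "1 \<le> n ^ 2"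
      using that by (simp_all add: power2_eq_square)
    then have "2 * b * n \<le> 2 * b * n ^ 2" and "d * 1 \<le> d * n ^ 2"
      using mult_le_mono2 by blast+
    ultimately have "run_time (2 * n) \<le> 4 * a * n ^ 2 + 2 * b * n ^ 2 + d * n ^ 2"
      by linarith
    then show ?thesis by (simp only: distrib_right)
  qed
  then have "real (run_time (2 * n)) \<le> real (4 * a + 2 * b + d) * real n ^ 2" if "1 \<le> n" for n
    using that by (metis of_nat_le_iff of_nat_mult of_nat_power)
  then show ?thesis
    by (intro bigoI[of _ "real (4 * a + 2 * b + d)"] eventually_sequentiallyI[of 1]) simp
qed

theorem theorem2p2:
  "\<exists>(prog :: program) (T :: nat \<Rightarrow> nat).
     (\<lambda>n. real (T n)) \<in> O(\<lambda>n. real n ^ 2) \<and>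
     (\<forall>D hs ps n.
        is_chord_diagram D \<longrightarrow> cyclic_enumeration D hs \<longrightarrow> length hs = 2 * n \<longrightarrow>
        partner_table D hs ps \<longrightarrow>
        (\<exists>t s. exec prog (initial_state ps) t s \<and> t \<le> T n \<and> result s = arc_number D))"
proof (intro exI[of _ arc_number_program] exI[of _ "\<lambda>n. run_time (2 * n)"] conjI allI impI)
  show "(\<lambda>n. real (run_time (2 * n))) \<in> O(\<lambda>n. real n ^ 2)"
    by (rule run_time_quadratic)
next
  fix D hs ps n
  assume D: "is_chord_diagram D" "cyclic_enumeration D hs" and n: "length hs = 2 * n"
    and ps: "partner_table D hs ps"
  have "ps ! j < length ps" if "j < length ps" for j
    using ps that by (simp add: partner_table_def)
  then have "reaches arc_number_program (initial_state ps) (run_time (length ps))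
    (\<lambda>\<sigma>. result \<sigma> = least_greedy ps (length ps))"
    by (rule arc_number_program_correct)
  moreover have "length ps = 2 * n" using ps n by (simp add: partner_table_def)
  ultimately show "\<exists>t s. exec arc_number_program (initial_state ps) t s \<and> t \<le> run_time (2 * n) \<and>
      result s = arc_number D"
    using arc_number_eq_least_greedy[OF D ps] by (simp add: reaches_def)
qed

end
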